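(* A linear operator $A=(a_{ij})_{i,j=1,\dots,n}$ (a real $n\times n$ matrix acting by $(A(x))_i=\sum_{j=1}^n a_{ij}x_j$) maps $\mathcal I_n$ to itself if and only if it satisfies one of the following conditions: (i) $a_{ij}\ge 0$ for all $i,j$, and $A$ has at least one zero row; (ii) $a_{ij}\ge 0$ for all $i,j$, and each row and each column of $A$ contains exactly one non-zero element.
   Context: $\mathbf R_{\max}=\mathbf R\cup\{-\infty\}$. The simplex of idempotent measures on $\{1,\dots,n\}$ is $$\mathcal I_n=\{(x_1,\dots,x_n)\in\mathbf R_{\max}^n:\ \max_{1\le i\le n}x_i=0\}.$$ Linearity is with respect to the usual operations $+$ and $\cdot$ (not max-plus operations). "Maps $\mathcal I_n$ to itself" means $A(x)\in\mathcal I_n$ for every $x\in\mathcal I_n$. Usual conventions for $-\infty$: $0\cdot(-\infty)=0$, $a\cdot(-\infty)=-\infty$ for real $a>0$, $a\cdot(-\infty)=+\infty$ for real $a<0$, $c+(-\infty)=-\infty$ for $c\in\mathbf R_{\max}$; if some coordinate of $A(x)$ is undefined or equals $+\infty$, then $A(x)\notin\mathcal I_n$.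
   Formalization: The formal theorem assumes n ≥ 2; for n = 1 the claim fails, since I_1 = {0} and A = (−1) maps I_1 to itself but satisfies neither (i) nor (ii). *)

theory Defs
  imports "HOL-Analysis.Analysis"
begin

definition Rmax :: "ereal set" where
  "Rmax = {c. c \<noteq> \<infinity>}"

definition idem_simplex :: "(ereal ^ 'n::finite) set" where
  "idem_simplex = {x. (\<forall>i. x $ i \<in> Rmax) \<and> Max (range (\<lambda>i. x $ i)) = 0}"

(* Products on ereal follow the usual conventions: 0 * (-\<infinity>) = 0, and a * (-\<infinity>) is
   -\<infinity> for a > 0 and \<infinity> for a < 0.  The library sets \<infinity> + (-\<infinity>) = \<infinity>, so a coordinate
   whose sum has a summand \<infinity> (an undefined one included) is \<infinity>, outside Rmax. *)
definition lin_apply :: "real ^ 'n ^ 'n \<Rightarrow> ereal ^ 'n \<Rightarrow> ereal ^ 'n::finite" where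
  "lin_apply A x = (\<chi> i. \<Sum>j\<in>UNIV. ereal (A $ i $ j) * x $ j)"

end

theory Submission
  imports Defs
begin

text \<open>
  A matrix preserving the simplex has no negative entry, since a negative entry \<open>a\<^sub>i\<^sub>j\<close> sends the point
  with \<open>-\<infinity>\<close> in place \<open>j\<close> and \<open>0\<close> elsewhere to a point with \<open>i\<close>-th coordinate \<open>+\<infinity>\<close>. Now let \<open>A \<ge> 0\<close>
  have no zero row. The image of the point with \<open>0\<close> in place \<open>j\<close> and \<open>-1\<close> elsewhere has a coordinate
  \<open>0\<close>, so some row of \<open>A\<close> has its only non-zero entry in place \<open>j\<close>. Choosing such a row for every
  \<open>j\<close> is injective, hence bijective, so every row is of this kind, for exactly one \<open>j\<close>.
\<close>

text \<open>The bound by \<open>0\<close> already excludes \<open>\<infinity>\<close>, so membership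
  in \<open>Rmax\<close> is absorbed.\<close>

lemma idem_simplex_iff: "x \<in> idem_simplex \<longleftrightarrow> (\<forall>i. x $ i \<le> 0) \<and> (\<exists>i. x $ i = 0)"
proof -
  have "0 \<in> range (\<lambda>i. x $ i) \<longleftrightarrow> (\<exists>i. x $ i = 0)"
    by (metis rangeE rangeI)
  then have "Max (range (\<lambda>i. x $ i)) = 0 \<longleftrightarrow> (\<forall>i. x $ i \<le> 0) \<and> (\<exists>i. x $ i = 0)"
    by (subst Max_eq_iff) auto
  moreover have "x $ i \<noteq> \<infinity>" if "x $ i \<le> 0" for i
    using that by auto
  ultimately show ?thesis
    by (auto simp: idem_simplex_def Rmax_def)
qed

lemma ereal_mult_nonneg_nonpos:
  fixes a b :: ereal
  assumes "0 \<le> a" "b \<le> 0"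
  shows "a * b \<le> 0"
  using assms by (simp add: ereal_mult_le_0_iff)

text \<open>Kept at the level of ordered monoids so that it applies to \<open>ereal\<close>, which
  is not a group.\<close>

lemma sum_nonpos_eq_0_iff:
  fixes f :: "'b \<Rightarrow> 'a::ordered_comm_monoid_add"
  assumes "finite S" "\<And>x. x \<in> S \<Longrightarrow> f x \<le> 0"
  shows "sum f S = 0 \<longleftrightarrow> (\<forall>x\<in>S. f x = 0)"
  using assms by (induct S) (simp_all add: add_nonpos_eq_0_iff sum_nonpos)

lemma lin_apply_nonpos:
  assumes "\<And>i j. A $ i $ j \<ge> 0" "\<And>j. x $ j \<le> 0"
  shows "lin_apply A x $ i \<le> 0"
  using assms by (auto simp: lin_apply_def intro!: sum_nonpos ereal_mult_nonneg_nonpos)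

text \<open>Nonpositive summands cannot cancel, and each product vanishes only through a zero
  factor, since \<open>0 * (-\<infinity>) = 0\<close>. So only the zero sets of the row and of
  \<open>x\<close> matter.\<close>

lemma lin_apply_eq_0_iff:
  assumes "\<And>i j. A $ i $ j \<ge> 0" "\<And>j. x $ j \<le> 0"
  shows "lin_apply A x $ i = 0 \<longleftrightarrow> (\<forall>j. A $ i $ j = 0 \<or> x $ j = 0)"
proof -
  have "lin_apply A x $ i = 0 \<longleftrightarrow> (\<forall>j\<in>UNIV. ereal (A $ i $ j) * x $ j = 0)"
    unfolding lin_apply_def vec_lambda_beta
    by (rule sum_nonpos_eq_0_iff) (use assms in \<open>auto intro: ereal_mult_nonneg_nonpos\<close>)
  then show ?thesis
    by simp
qed

lemma nonneg_if_preserves_idem_simplex: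
  fixes A :: "real ^ 'n ^ 'n::finite"
  assumes "CARD('n) \<ge> 2"
    and pres: "\<forall>x\<in>idem_simplex. lin_apply A x \<in> idem_simplex"
  shows "A $ i $ j \<ge> 0"
proof (rule ccontr)
  assume "\<not> A $ i $ j \<ge> 0"
  define x :: "ereal ^ 'n" where "x = (\<chi> k. if k = j then -\<infinity> else 0)"
  \<comment> \<open>A second coordinate is needed to carry the value \<open>0\<close>; otherwise
    \<open>x\<close> would lie outside the simplex.\<close>
  have "UNIV \<noteq> {j}"
  proof
    assume "UNIV = {j}"
    then have "CARD('n) = card {j}"
      by (rule arg_cong)
    then show False
      using assms(1) by simp
  qed
  then obtain k where "k \<noteq> j"
    by blast
  then have "x \<in> idem_simplex"
    by (auto simp: idem_simplex_iff x_def)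
  then have "lin_apply A x $ i \<le> 0"
    using pres by (simp add: idem_simplex_iff)
  moreover have "ereal (A $ i $ j) * x $ j = \<infinity>"
    using \<open>\<not> A $ i $ j \<ge> 0\<close> by (simp add: x_def)
  then have "lin_apply A x $ i = \<infinity>"
    unfolding lin_apply_def vec_lambda_beta sum_Pinfty by (intro conjI finite bexI UNIV_I)
  ultimately show False
    by simp
qed

text \<open>The row found may be zero, so the conclusion covers both kinds of matrix.\<close>

lemma ex_row_supported_in_column:
  fixes A :: "real ^ 'n ^ 'n::finite"
  assumes nonneg: "\<And>i j. A $ i $ j \<ge> 0"
    and pres: "\<forall>x\<in>idem_simplex. lin_apply A x \<in> idem_simplex"
  shows "\<exists>i. \<forall>k. k \<noteq> j \<longrightarrow> A $ i $ k = 0"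
proof -
  \<comment> \<open>Any negative value could replace \<open>-1\<close>, as only the zero set of
    \<open>x\<close> counts.\<close>
  define x :: "ereal ^ 'n" where "x = (\<chi> k. if k = j then 0 else -1)"
  have x: "x \<in> idem_simplex"
    by (auto simp: idem_simplex_iff x_def)
  then have "\<And>k. x $ k \<le> 0" and "\<exists>i. lin_apply A x $ i = 0"
    using pres by (auto simp: idem_simplex_iff)
  then obtain i where "\<forall>k. A $ i $ k = 0 \<or> x $ k = 0"
    using lin_apply_eq_0_iff nonneg by blast
  moreover have "x $ k \<noteq> 0" if "k \<noteq> j" for k
    using that by (simp add: x_def)
  ultimately show ?thesis
    by blast
qed

lemma monomial_if_rows_supported_in_columns:
  fixes A :: "real ^ 'n ^ 'n::finite"
  assumes supp: "\<And>j. \<exists>i. \<forall>k. k \<noteq> j \<longrightarrow> A $ i $ k = 0"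
    and nonzero: "\<And>i. row i A \<noteq> 0"
  shows "(\<forall>i. \<exists>!j. A $ i $ j \<noteq> 0) \<and> (\<forall>j. \<exists>!i. A $ i $ j \<noteq> 0)"
proof -
  have "\<forall>j. \<exists>i. \<forall>k. A $ i $ k \<noteq> 0 \<longleftrightarrow> k = j"
  proof
    fix j
    obtain i where i: "\<forall>k. k \<noteq> j \<longrightarrow> A $ i $ k = 0"
      using supp by blast
    moreover obtain k where "A $ i $ k \<noteq> 0"
      using nonzero[of i] by (auto simp: row_def vec_eq_iff)
    ultimately have "\<forall>k. A $ i $ k \<noteq> 0 \<longleftrightarrow> k = j"
      by auto
    then show "\<exists>i. \<forall>k. A $ i $ k \<noteq> 0 \<longleftrightarrow> k = j" ..
  qed
  then obtain r where "\<forall>j k. A $ r j $ k \<noteq> 0 \<longleftrightarrow> k = j"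
    unfolding choice_iff ..
  then have iff: "A $ r j $ k \<noteq> 0 \<longleftrightarrow> k = j" for j k
    by blast
  have "inj r"
  proof (rule injI)
    fix j k
    assume "r j = r k"
    then show "j = k"
      using iff[of j j] iff[of k j] by simp
  qed
  then have "surj r"
    by (simp add: finite_UNIV_inj_surj)
  have "\<exists>!j. A $ i $ j \<noteq> 0" for i
  proof -
    obtain k where "i = r k"
      using \<open>surj r\<close> by blast
    then show ?thesis
      by (simp add: iff)
  qed
  \<comment> \<open>By surjectivity every row is some \<open>r k\<close>, whose only non-zero entry
    is in column \<open>k\<close>; this forces \<open>k = j\<close>.\<close>
  moreover have "\<exists>!i. A $ i $ j \<noteq> 0" for j
  proof (rule ex1I)
    show "A $ r j $ j \<noteq> 0"
      by (simp add: iff)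
    fix i
    assume "A $ i $ j \<noteq> 0"
    moreover obtain k where "i = r k"
      using \<open>surj r\<close> by blast
    ultimately show "i = r j"
      by (simp add: iff)
  qed
  ultimately show ?thesis
    by blast
qed

theorem theorem2p1:
  fixes A :: "real ^ 'n ^ 'n::finite"
  assumes "CARD('n) \<ge> 2"
  shows "(\<forall>x\<in>idem_simplex. lin_apply A x \<in> idem_simplex) \<longleftrightarrow>
    ((\<forall>i j. A $ i $ j \<ge> 0) \<and> (\<exists>i. row i A = 0)) \<or>
    ((\<forall>i j. A $ i $ j \<ge> 0) \<and>
      (\<forall>i. \<exists>!j. A $ i $ j \<noteq> 0) \<and> (\<forall>j. \<exists>!i. A $ i $ j \<noteq> 0))"
    (is "?pres \<longleftrightarrow> ?zero_row \<or> ?monomial")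
proof
  assume pres: ?pres
  have nonneg: "\<And>i j. A $ i $ j \<ge> 0"
    by (rule nonneg_if_preserves_idem_simplex[OF assms pres])
  \<comment> \<open>If no row is zero, the premise \<open>nonzero\<close> of the monomial lemma
    holds.\<close>
  show "?zero_row \<or> ?monomial"
    using nonneg monomial_if_rows_supported_in_columns[OF ex_row_supported_in_column[OF nonneg pres]]
    by blast
next
  assume rhs: "?zero_row \<or> ?monomial"
  then have nonneg: "\<And>i j. A $ i $ j \<ge> 0"
    by blast
  show ?pres
  proof
    fix x :: "ereal ^ 'n"
    assume "x \<in> idem_simplex"
    then obtain j where x: "\<And>k. x $ k \<le> 0" and j: "x $ j = 0"
      by (auto simp: idem_simplex_iff)
    \<comment> \<open>Both conditions yield such a row: a zero row, or the one with its non-zero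
      entry in column \<open>j\<close>. As \<open>x $ j = 0\<close>, the image vanishes
      there.\<close>
    have "\<exists>i. \<forall>k. k \<noteq> j \<longrightarrow> A $ i $ k = 0"
      using rhs
    proof
      assume ?zero_row
      then show ?thesis
        by (auto simp: row_def vec_eq_iff)
    next
      assume ?monomial
      then show ?thesis
        by metis
    qed
    then have "\<exists>i. lin_apply A x $ i = 0"
      using j by (metis lin_apply_eq_0_iff nonneg x)
    then show "lin_apply A x \<in> idem_simplex"
      using lin_apply_nonpos[OF nonneg x] by (auto simp: idem_simplex_iff)
  qed
qed

end
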